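(* Let $m,n\ge 1$ be integers and let $a>1$ be a fixed real number. The number of regions of the arrangement $\mathcal{A}_n^{(m)}$ is $\dfrac{2(nm+n+1)!}{(nm+2)!}$.
   Context: $\mathcal{A}_n^{(m)}$ denotes the hyperplane arrangement in $\mathbb{R}^n$ given by $\{x_i=0 \mid i\in[n]\}\cup\{x_i=a^kx_j \mid k\in[-m,m],\ 1\le i<j\le n\}$, where $[n]=\{1,\dots,n\}$ and $[-m,m]$ is the set of integers from $-m$ to $m$. A region of an arrangement is a connected component of the complement in $\mathbb{R}^n$ of the union of its hyperplanes. *)

theory Defs
  imports "HOL-Analysis.Analysis"
begin

text \<open>
  The index set \<open>[n] = {1, ..., n}\<close> is rendered by a finite linearly ordered type \<open>'n\<close> with
  \<open>CARD('n) = n\<close>; every \<open>n \<ge> 1\<close> is realised, for instance by the numeral types.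
\<close>

definition exp_arrangement ::
  "real \<Rightarrow> nat \<Rightarrow> (real ^ 'n::{finite,linorder}) set set" where
  "exp_arrangement a m =
     {{x. x $ i = 0} | i. True} \<union>
     {{x. x $ i = a powi k * x $ j} | k i j. k \<in> {- int m..int m} \<and> i < j}"

definition regions :: "'v::topological_space set set \<Rightarrow> 'v set set" where
  "regions \<H> = components (- \<Union>\<H>)"

end

theory Submission
  imports Defs
begin

text \<open>
  A point off all the hyperplanes has distinct nonzero coordinates. Read its coordinates from left
  to right on the real line. Besides \<open>0\<close>, every coordinate \<open>u\<close> that has been read contributes \<open>m\<close>
  \<^emph>\<open>tokens\<close> to its right, namely the numbers \<open>a\<^sup>k u\<close> if \<open>u > 0\<close> and \<open>a\<^sup>-\<^sup>k u\<close> if \<open>u < 0\<close>, where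
  \<open>1 \<le> k \<le> m\<close>. The hyperplanes say exactly that a coordinate meets a token, so a region amounts to
  the order of the coordinates together with the gap between tokens in which each of them lies.
  It is enough to record, for each coordinate, its index \<open>i\<close> and the number \<open>r\<close> of tokens to the
  right of it when it is read. This list of pairs is the code of the region.

  Before anything is read one token, the number \<open>0\<close>, is ahead; just after a coordinate with \<open>r\<close> tokens
  ahead has been read, \<open>r + m\<close> tokens are ahead of it. Hence the counts satisfy \<open>r\<^sub>1 \<le> 1\<close> and
  \<open>r\<^sub>p\<^sub>+\<^sub>1 \<le> r\<^sub>p + m\<close>. Conversely every list with these bounds is a code, because the next coordinate
  may be put into any of the gaps that are left (\<open>valid_realizable\<close>). Two points with the same code
  compare in the same way with all tokens (\<open>realizes_same_type\<close>), hence lie in the same cell,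
  an intersection of open half-spaces (\<open>same_type_class_eq_cell\<close>). So the regions correspond to the
  valid codes (\<open>card_regions\<close>). Treating positive and negative coordinates on one line, with \<open>0\<close> as a
  token, avoids summing over the orthants.

  Removing the oldest entry of a code gives a recursion for the number of codes with initial bound \<open>h\<close>.
  Its solution is \<open>n!\<close> times the Raney number
  \<open>(h + 1) / (h + 1 + (m + 1) n) * ((h + 1 + (m + 1) n) choose n)\<close>, which
  \<open>code_count_closed_form\<close> states with denominators cleared; the theorem is the case \<open>h = 1\<close>.
\<close>

section \<open>Counting codes\<close>

text \<open>
  Codes are stored with the newest entry at the head. The parameter \<open>h\<close> is the number of tokens
  present at the start, kept general because the recursion on the oldest entry changes it.
\<close>

fun bound :: "nat \<Rightarrow> nat \<Rightarrow> ('b \<times> nat) list \<Rightarrow> nat" where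
  "bound m h [] = h"
| "bound m h ((i, r) # w) = r + m"

fun valid :: "nat \<Rightarrow> nat \<Rightarrow> ('b \<times> nat) list \<Rightarrow> bool" where
  "valid m h [] \<longleftrightarrow> True"
| "valid m h ((i, r) # w) \<longleftrightarrow> valid m h w \<and> i \<notin> fst ` set w \<and> r \<le> bound m h w"

lemma bound_snoc: "bound m h (w @ [(i, r)]) = bound m (r + m) w"
  by (cases w) auto

lemma valid_snoc:
  "valid m h (w @ [(i, r)]) \<longleftrightarrow> r \<le> h \<and> valid m (r + m) w \<and> i \<notin> fst ` set w"
  by (induction w) (auto simp: bound_snoc)

fun code_count :: "nat \<Rightarrow> nat \<Rightarrow> nat \<Rightarrow> nat" where
  "code_count m 0 h = 1"
| "code_count m (Suc n) h = Suc n * (\<Sum>r\<le>h. code_count m n (r + m))"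

text \<open>
  The recursion splits off the last list element, that is the oldest entry \<open>(i, r)\<close>: what is left is a
  code for the other indices that starts with \<open>r + m\<close> tokens.
\<close>

lemma card_valid:
  assumes "finite A"
  shows "finite {w. valid m h w \<and> fst ` set w = A} \<and>
         card {w. valid m h w \<and> fst ` set w = A} = code_count m (card A) h"
  using assms
proof (induction "card A" arbitrary: A h)
  case 0
  then have "{w. valid m h w \<and> fst ` set w = A} = {[]}" by auto
  then show ?case using 0 by simp
next
  case (Suc n)
  define C where "C B h = {w :: ('a \<times> nat) list. valid m h w \<and> fst ` set w = B}" for B h
  define D where "D p = (\<lambda>w. w @ [p]) ` C (A - {fst p}) (snd p + m)" for p
  have IH: "finite (C (A - {i}) h')" "card (C (A - {i}) h') = code_count m n h'"
    if "i \<in> A" for i h'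
    using Suc.hyps(1)[of "A - {i}" h'] Suc.hyps(2)[symmetric] Suc.prems that
    by (auto simp: C_def)
  have "C A h = (\<Union>p\<in>A \<times> {..h}. D p)"
  proof (intro equalityI subsetI)
    fix w assume w: "w \<in> C A h"
    then have "w \<noteq> []" using Suc.hyps(2) by (auto simp: C_def)
    then obtain v i r where v: "w = v @ [(i, r)]"
      by (metis rev_exhaust surj_pair)
    from w have "v \<in> C (A - {i}) (r + m)" "i \<in> A" "r \<le> h"
      by (auto simp: C_def v valid_snoc)
    then show "w \<in> (\<Union>p\<in>A \<times> {..h}. D p)"
      by (auto simp: D_def v)
  next
    fix w assume "w \<in> (\<Union>p\<in>A \<times> {..h}. D p)"
    then obtain i r v where v: "i \<in> A" "r \<le> h" "v \<in> C (A - {i}) (r + m)" "w = v @ [(i, r)]"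
      by (auto simp: D_def)
    then have "fst ` set w = insert i (A - {i})" by (simp add: C_def)
    with v show "w \<in> C A h" by (auto simp: C_def valid_snoc)
  qed
  moreover have fin: "finite (D p)" and cardD: "card (D p) = code_count m n (snd p + m)"
    if "p \<in> A \<times> {..h}" for p
    using that IH by (auto simp: D_def card_image inj_on_def)
  moreover have "card (\<Union>p\<in>A \<times> {..h}. D p) = (\<Sum>p\<in>A \<times> {..h}. card (D p))"
    by (rule card_UN_disjoint) (use Suc.prems fin in \<open>auto simp: D_def\<close>)
  moreover have "(\<Sum>p\<in>A \<times> {..h}. card (D p)) = (\<Sum>p\<in>A \<times> {..h}. code_count m n (snd p + m))"
    using cardD by (intro sum.cong) auto
  moreover have "\<dots> = card A * (\<Sum>r\<le>h. code_count m n (r + m))"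
    by (subst sum.Sigma [of A "\<lambda>_. {..h}" "\<lambda>_ r. code_count m n (r + m)", symmetric,
          unfolded case_prod_unfold]) (use Suc.prems in auto)
  ultimately have "finite (C A h) \<and> card (C A h) = card A * (\<Sum>r\<le>h. code_count m n (r + m))"
    using Suc.prems by auto
  then show ?case using Suc.hyps(2)[symmetric] by (simp add: C_def)
qed

text \<open>
  For fixed \<open>n\<close> the recursion says that increasing \<open>h\<close> by one adds \<open>n\<close> times the count for
  \<open>n - 1\<close> and \<open>h + m\<close>, so an inner induction on \<open>h\<close> reduces the claim to a polynomial identity.
\<close>

lemma code_count_closed_form:
  "code_count m n h * fact (h + 1 + m * n) = ((h + 1) * fact (h + (m + 1) * n) :: nat)"
proof (induction n arbitrary: h)
  case 0
  show ?case by simp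
next
  case (Suc n)
  show ?case
  proof (induction h)
    case 0
    have "code_count m n m * fact (Suc (m + m * n)) = Suc m * fact (m + (n + m * n))"
      using Suc.IH[of m] by simp
    then have "Suc n * (code_count m n m * fact (Suc (m + m * n)))
        = Suc (n + (m + m * n)) * fact (n + (m + m * n)) "
      by (simp add: algebra_simps)
    then show ?case by (simp add: algebra_simps)
  next
    case (Suc h)
    define c where "c = code_count m (Suc n) h"
    define d where "d = code_count m n (Suc h + m)"
    define p where "p = h + 1 + m * Suc n"
    define q where "q = h + (m + 1) * Suc n"
    have 1: "c * fact p = (h + 1) * fact q"
      using Suc.IH by (simp add: c_def p_def q_def)
    have "Suc h + m + 1 + m * n = Suc p" "Suc h + m + (m + 1) * n = q"
      by (simp_all add: p_def q_def algebra_simps)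
    then have 2: "d * (Suc p * fact p) = (h + m + 2) * fact q"
      using \<open>\<And>h. code_count m n h * fact (h + 1 + m * n) = (h + 1) * fact (h + (m + 1) * n)\<close>
        [of "Suc h + m"]
      by (simp add: d_def)
    have 3: "code_count m (Suc n) (Suc h) = c + Suc n * d"
      by (simp add: c_def d_def algebra_simps)
    have 4: "Suc h + 1 + m * Suc n = Suc p" "Suc h + (m + 1) * Suc n = Suc q"
      by (simp_all add: p_def q_def)
    have "(c + Suc n * d) * (Suc p * fact p) = Suc p * (c * fact p) + Suc n * (d * (Suc p * fact p))"
      by (simp add: algebra_simps)
    also have "\<dots> = (Suc p * (h + 1) + Suc n * (h + m + 2)) * fact q"
      unfolding 1 2 by (simp add: algebra_simps)
    also have "Suc p * (h + 1) + Suc n * (h + m + 2) = (Suc h + 1) * Suc q"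
      by (simp add: p_def q_def algebra_simps)
    finally show ?case unfolding 3 4 by (simp add: algebra_simps)
  qed
qed

section \<open>Cells of a central arrangement\<close>

text \<open>
  The points that lie on the same side as \<open>x\<close> of each hyperplane through the origin with a normal in
  \<open>K\<close>; the cell is empty if \<open>x\<close> lies on one of them.
\<close>

definition cell :: "'v::euclidean_space set \<Rightarrow> 'v \<Rightarrow> 'v set" where
  "cell K x = {y. \<forall>v\<in>K. 0 < (v \<bullet> x) * (v \<bullet> y)}"

lemma cell_eq_Inter_halfspaces: "cell K x = (\<Inter>v\<in>K. {y. 0 < ((v \<bullet> x) *\<^sub>R v) \<bullet> y})"
  by (auto simp: cell_def)

lemma convex_cell: "convex (cell K x)"
  unfolding cell_eq_Inter_halfspaces
  by (auto intro!: convex_INT convex_halfspace_gt simp del: inner_scaleR_left)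

lemma open_cell: "finite K \<Longrightarrow> open (cell K x)"
  unfolding cell_eq_Inter_halfspaces
  by (auto intro!: open_INT open_halfspace_gt simp del: inner_scaleR_left)

section \<open>Shifts of the real line\<close>

locale shifts =
  fixes a :: real and m :: nat
  assumes a_gt_1: "a > 1"
begin

text \<open>
  The power of \<open>a\<close> is inverted on negative numbers so that shifts always move to the right. This makes
  them an action of the natural numbers by increasing bijections of the line that fix \<open>0\<close>.
\<close>

definition shift :: "nat \<Rightarrow> real \<Rightarrow> real" where
  "shift k u = (if u > 0 then a ^ k * u else u / a ^ k)"

lemma a_pos [simp]: "a > 0" "a \<noteq> 0" "\<not> a < 0" using a_gt_1 by auto

lemma power_a_pos [simp]: "0 < a ^ k" by simp

lemma shift_0 [simp]: "shift 0 u = u"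
  by (simp add: shift_def)

lemma shift_zero [simp]: "shift k 0 = 0"
  by (simp add: shift_def)

lemma shift_pos_iff [simp]: "0 < shift k u \<longleftrightarrow> 0 < u"
  by (auto simp: shift_def zero_less_mult_iff zero_less_divide_iff)

lemma shift_neg_iff [simp]: "shift k u < 0 \<longleftrightarrow> u < 0"
  by (auto simp: shift_def divide_simps mult_less_0_iff)

lemma shift_shift: "shift k (shift l u) = shift (k + l) u"
  using shift_pos_iff[of l u]
  by (auto simp: shift_def power_add divide_simps)

lemma shift_less_iff [simp]: "shift k u < shift k v \<longleftrightarrow> u < v"
proof (cases "u > 0 \<longleftrightarrow> v > 0")
  case True
  then show ?thesis by (auto simp: shift_def divide_simps)
next
  case False
  then show ?thesis using shift_pos_iff[of k u] shift_pos_iff[of k v] by linarith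
qed

lemma shift_eq_iff [simp]: "shift k u = shift k v \<longleftrightarrow> u = v"
  by (metis linorder_neq_iff shift_less_iff)

lemma less_shift: "u \<noteq> 0 \<Longrightarrow> u < shift k u \<longleftrightarrow> k > 0"
proof (cases "k = 0")
  case False
  then have "1 < a ^ k" using a_gt_1 by (simp add: one_less_power)
  then show "u \<noteq> 0 \<Longrightarrow> ?thesis" using False by (auto simp: shift_def divide_simps)
qed simp

lemma le_shift: "u \<le> shift k u"
  using less_shift[of u k] by (cases "u = 0"; cases "k = 0") auto

text \<open>
  Comparing two shifted numbers reduces to comparing one number with a shift of the other, by
  cancelling the common part of the shifts.
\<close>

lemma shift_less_shift:
  "shift k u < shift l v \<longleftrightarrow> (if l \<le> k then shift (k - l) u < v else u < shift (l - k) v)"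
proof (cases "l \<le> k")
  case True
  then have "shift k u = shift l (shift (k - l) u)" by (simp add: shift_shift)
  with True show ?thesis by simp
next
  case False
  then have "shift l v = shift k (shift (l - k) v)" by (simp add: shift_shift)
  with False show ?thesis by simp
qed

lemma shift_eq_shift:
  "shift k u = shift l v \<longleftrightarrow> (if l \<le> k then shift (k - l) u = v else u = shift (l - k) v)"
proof (cases "l \<le> k")
  case True
  then have "shift k u = shift l (shift (k - l) u)" by (simp add: shift_shift)
  with True show ?thesis by simp
next
  case False
  then have "shift l v = shift k (shift (l - k) v)" by (simp add: shift_shift)
  with False show ?thesis by simp
qed

lemma shift_eq_powi: "shift k v = a powi (if v > 0 then int k else - int k) * v"
  by (simp add: shift_def power_int_minus divide_inverse mult.commute)

lemma powi_eq_shift: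
  assumes "(k \<ge> 0) = (v > 0)"
  shows "a powi k * v = shift (nat \<bar>k\<bar>) v"
  using assms by (auto simp: shift_eq_powi)

lemma eq_powi_swap: "u = a powi k * v \<longleftrightarrow> v = a powi (- k) * u"
  by (auto simp: power_int_minus)

lemma less_powi_swap: "u < a powi k * v \<longleftrightarrow> a powi (- k) * u < v"
  by (simp add: power_int_minus field_simps)

text \<open>
  The factor \<open>a powi k\<close> moves \<open>v\<close> to the right exactly if \<open>k \<ge> 0\<close> and \<open>v > 0\<close> agree (up to the case
  \<open>k = 0\<close>, where nothing moves). Otherwise the inverse factor is moved to \<open>u\<close>, which it shifts to
  the right if \<open>u\<close> and \<open>v\<close> have the same sign; for different signs both sides are decided by the signs.
\<close>

lemma
  assumes "u \<noteq> 0" "v \<noteq> 0"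
  shows less_powi_iff_shift: "u < a powi k * v \<longleftrightarrow>
    (if (k \<ge> 0) = (v > 0) then u < shift (nat \<bar>k\<bar>) v else shift (nat \<bar>k\<bar>) u < v)"
   and eq_powi_iff_shift: "u = a powi k * v \<longleftrightarrow>
    (if (k \<ge> 0) = (v > 0) then u = shift (nat \<bar>k\<bar>) v else shift (nat \<bar>k\<bar>) u = v)"
proof -
  have "(u < a powi k * v \<longleftrightarrow> shift (nat \<bar>k\<bar>) u < v) \<and> (u = a powi k * v \<longleftrightarrow> shift (nat \<bar>k\<bar>) u = v)"
    if "(k \<ge> 0) \<noteq> (v > 0)"
  proof (cases "u > 0 \<longleftrightarrow> v > 0")
    case True
    then have "a powi (- k) * u = shift (nat \<bar>k\<bar>) u"
      using that powi_eq_shift[of "- k" u] by (cases "k = 0") auto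
    then show ?thesis using less_powi_swap[of u k v] eq_powi_swap[of u k v] by auto
  next
    case False
    have "0 < a powi k * v \<longleftrightarrow> 0 < v" "a powi k * v \<noteq> 0"
      using assms zero_less_power_int[OF a_pos(1), of k]
      by (auto simp: zero_less_mult_iff simp del: zero_less_power_int dest: less_asym)
    then show ?thesis
      using False assms shift_pos_iff[of "nat \<bar>k\<bar>" u] shift_neg_iff[of "nat \<bar>k\<bar>" u] by linarith
  qed
  then show "u < a powi k * v \<longleftrightarrow>
    (if (k \<ge> 0) = (v > 0) then u < shift (nat \<bar>k\<bar>) v else shift (nat \<bar>k\<bar>) u < v)"
   and "u = a powi k * v \<longleftrightarrow>
    (if (k \<ge> 0) = (v > 0) then u = shift (nat \<bar>k\<bar>) v else shift (nat \<bar>k\<bar>) u = v)"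
    using powi_eq_shift[of k v] by auto
qed

section \<open>Points and their codes\<close>

text \<open>
  The label \<open>None\<close> stands for the token \<open>0\<close>, and \<open>Some (j, k)\<close> for the \<open>k\<close>-th shift of the coordinate
  \<open>j\<close>. Counting labels instead of values makes counts at different points comparable.
\<close>

definition tok :: "('b \<Rightarrow> real) \<Rightarrow> ('b \<times> nat) option \<Rightarrow> real" where
  "tok x b = (case b of None \<Rightarrow> 0 | Some (j, k) \<Rightarrow> shift k (x j))"

definition labels :: "'b set \<Rightarrow> ('b \<times> nat) option set" where
  "labels S = insert None (Some ` (S \<times> {1..m}))"

definition ahead :: "('b \<Rightarrow> real) \<Rightarrow> 'b set \<Rightarrow> real \<Rightarrow> nat" where
  "ahead x S y = card {b \<in> labels S. y < tok x b}"

text \<open>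
  Avoiding the hyperplanes among the coordinates in \<open>S\<close>, expressed by shifts; \<open>k = 0\<close> is included,
  so the coordinates in \<open>S\<close> are distinct.
\<close>

definition generic :: "('b \<Rightarrow> real) \<Rightarrow> 'b set \<Rightarrow> bool" where
  "generic x S \<longleftrightarrow> (\<forall>i\<in>S. x i \<noteq> 0 \<and> (\<forall>j\<in>S - {i}. \<forall>k\<le>m. x i \<noteq> shift k (x j)))"

text \<open>Two generic points have the same type if they are on the same side of every hyperplane.\<close>

definition same_type :: "('b \<Rightarrow> real) \<Rightarrow> ('b \<Rightarrow> real) \<Rightarrow> 'b set \<Rightarrow> bool" where
  "same_type x y S \<longleftrightarrow> (\<forall>i\<in>S. (x i < 0 \<longleftrightarrow> y i < 0) \<and>
     (\<forall>j\<in>S. \<forall>k\<le>m. x i < shift k (x j) \<longleftrightarrow> y i < shift k (y j)))"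

text \<open>
  The code \<open>w\<close> is the one obtained by reading the coordinates of \<open>x\<close> with indices in \<open>fst ` set w\<close> from
  left to right. The strict inequality forces the indices to be distinct.
\<close>

fun realizes :: "('b \<Rightarrow> real) \<Rightarrow> ('b \<times> nat) list \<Rightarrow> bool" where
  "realizes x [] \<longleftrightarrow> True"
| "realizes x ((i, r) # w) \<longleftrightarrow> realizes x w \<and> (\<forall>j\<in>fst ` set w. x j < x i) \<and>
     r = ahead x (fst ` set w) (x i)"

lemma tok_simps [simp]: "tok x None = 0" "tok x (Some (j, k)) = shift k (x j)"
  by (simp_all add: tok_def)

lemma finite_labels: "finite S \<Longrightarrow> finite (labels S)"
  by (simp add: labels_def)

text \<open>This is the source of the bound \<open>r + m\<close>: all \<open>m\<close> new tokens lie to the right of the new coordinate.\<close>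

lemma ahead_insert_self:
  assumes "finite S" "i \<notin> S" "x i \<noteq> 0"
  shows "ahead x (insert i S) (x i) = ahead x S (x i) + m"
proof -
  have "{b \<in> labels (insert i S). x i < tok x b} =
        {b \<in> labels S. x i < tok x b} \<union> (\<lambda>k. Some (i, k)) ` {1..m}"
    using assms(3) by (auto simp: labels_def less_shift)
  moreover have "{b \<in> labels S. x i < tok x b} \<inter> (\<lambda>k. Some (i, k)) ` {1..m} = {}"
    using assms(2) by (auto simp: labels_def)
  moreover have "card ((\<lambda>k. Some (i, k)) ` {1..m}) = m"
    by (simp add: card_image inj_on_def)
  ultimately show ?thesis
    using finite_labels[OF assms(1)] by (simp add: ahead_def card_Un_disjoint)
qed

lemma ahead_antimono:
  assumes "finite S" "y \<le> z"
  shows "ahead x S z \<le> ahead x S y"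
  unfolding ahead_def using finite_labels[OF assms(1)] assms(2) by (intro card_mono) auto

lemma generic_subset: "generic x S \<Longrightarrow> T \<subseteq> S \<Longrightarrow> generic x T"
  by (auto simp: generic_def)

lemma inj_on_tok:
  assumes "generic x S"
  shows "inj_on (tok x) (labels S)"
proof -
  have nz: "shift k (x i) \<noteq> 0" if "i \<in> S" for i k
    using assms that shift_eq_iff[of k "x i" 0] by (auto simp: generic_def simp del: shift_eq_iff)
  have ne: "i = j \<and> k = l" if "i \<in> S" "j \<in> S" "k \<le> m" "l \<le> m" "shift k (x i) = shift l (x j)"
    for i j k l
  proof (cases "i = j")
    case True
    then show ?thesis using assms that less_shift[of "x i" "k - l"] less_shift[of "x i" "l - k"]
      by (auto simp: generic_def shift_eq_shift split: if_splits)
  next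
    case False
    have "k - l \<le> m" "l - k \<le> m" using that by auto
    then show ?thesis using False assms that(1,2,5)
      unfolding generic_def shift_eq_shift by (metis Diff_iff singletonD)
  qed
  show ?thesis
    by (rule inj_onI) (use nz ne in \<open>force simp: labels_def\<close>)
qed

text \<open>
  Having the same type only speaks of coordinates against tokens, but this determines the order
  of the tokens as well, since two tokens are compared by cancelling the common shift.
\<close>

lemma same_type_tok_less_iff:
  assumes "generic x S" "generic y S" "same_type x y S" "b \<in> labels S" "c \<in> labels S"
  shows "tok x b < tok x c \<longleftrightarrow> tok y b < tok y c"
proof -
  have nz: "x i \<noteq> 0" "y i \<noteq> 0" "x i < 0 \<longleftrightarrow> y i < 0" if "i \<in> S" for i
    using assms that by (auto simp: generic_def same_type_def)
  have "0 < x i \<longleftrightarrow> 0 < y i" if "i \<in> S" for i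
    using nz[OF that] by linarith
  moreover have "shift k (x i) < shift l (x j) \<longleftrightarrow> shift k (y i) < shift l (y j)"
    if "i \<in> S" "j \<in> S" "k \<le> m" "l \<le> m" for i j k l
  proof (cases "l \<le> k")
    case True
    have "k - l \<le> m" using that by auto
    then have "x j < shift (k - l) (x i) \<longleftrightarrow> y j < shift (k - l) (y i)"
      "i \<noteq> j \<Longrightarrow> x j \<noteq> shift (k - l) (x i)" "i \<noteq> j \<Longrightarrow> y j \<noteq> shift (k - l) (y i)"
      using assms that unfolding same_type_def generic_def by auto
    then have "shift (k - l) (x i) < x j \<longleftrightarrow> shift (k - l) (y i) < y j"
      using le_shift[of "x i" "k - l"] le_shift[of "y i" "k - l"] by (cases "i = j") force+
    with True show ?thesis by (simp add: shift_less_shift)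
  next
    case False
    have "l - k \<le> m" using that by auto
    then show ?thesis using False assms that by (simp add: shift_less_shift same_type_def)
  qed
  ultimately show ?thesis
    using nz(3) assms(4,5) by (auto simp: labels_def)
qed

text \<open>
  The code determines the type. When the newest coordinate is read, the tokens to the right of
  it form an upper set of the tokens. By induction the tokens are ordered in the same way at both
  points, so the two upper sets are comparable, and as they have the same size they are equal.
  Comparisons of older coordinates with the new tokens are forced by the reading order.
\<close>

lemma realizes_same_type:
  assumes "realizes x w" "realizes y w" "generic x (fst ` set w)" "generic y (fst ` set w)"
  shows "same_type x y (fst ` set w)"
  using assms
proof (induction w)
  case Nil
  then show ?case by (simp add: same_type_def)
next
  case (Cons p w)
  obtain i r where p: "p = (i, r)" by fastforce
  define S where "S = fst ` set w"
  have gen: "generic x S" "generic y S"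
    using Cons.prems generic_subset by (auto simp: S_def p)
  then have st: "same_type x y S"
    using Cons by (auto simp: S_def p)
  have less: "x j < x i" "y j < y i" if "j \<in> S" for j
    using Cons.prems that by (auto simp: S_def p)
  have nz: "x i \<noteq> 0" "y i \<noteq> 0" using Cons.prems by (auto simp: generic_def p)
  define X where "X = {b \<in> labels S. x i < tok x b}"
  define Y where "Y = {b \<in> labels S. y i < tok y b}"
  have "finite X" "finite Y" by (auto simp: X_def Y_def S_def finite_labels)
  have "card X = card Y"
    using Cons.prems by (simp add: X_def Y_def S_def p ahead_def)
  have "X \<subseteq> Y \<or> Y \<subseteq> X"
  proof (rule ccontr)
    assume "\<not> ?thesis"
    then obtain b c where bc: "b \<in> X" "b \<notin> Y" "c \<in> Y" "c \<notin> X" by auto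
    then have "b \<in> labels S" "c \<in> labels S" "tok x c < tok x b" "\<not> tok y c < tok y b"
      by (auto simp: X_def Y_def)
    then show False using same_type_tok_less_iff[OF gen st] by blast
  qed
  then have "X = Y"
    using \<open>card X = card Y\<close> \<open>finite X\<close> \<open>finite Y\<close> by (metis card_subset_eq)
  then have eq: "x i < tok x b \<longleftrightarrow> y i < tok y b" if "b \<in> labels S" for b
    using that by (auto simp: X_def Y_def)
  have "x i < 0 \<longleftrightarrow> y i < 0"
    using eq[of None] by (simp add: labels_def)
  moreover have "x i < shift k (x j) \<longleftrightarrow> y i < shift k (y j)" if "j \<in> S" "k \<le> m" for j k
    using eq[of "Some (j, k)"] less[OF that(1)] that by (cases "k = 0") (auto simp: labels_def)
  moreover have "x j < shift k (x i)" "y j < shift k (y i)" if "j \<in> S" for j k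
    using less[OF that] le_shift[of "x i" k] le_shift[of "y i" k] by auto
  ultimately have "same_type x y (insert i S)"
    using st less_shift nz by (auto simp: same_type_def)
  then show ?case by (simp add: p S_def)
qed

lemma same_type_realizes:
  assumes "realizes x w" "same_type x y (fst ` set w)"
  shows "realizes y w"
  using assms
proof (induction w)
  case (Cons p w)
  obtain i r where p: "p = (i, r)" by fastforce
  define S where "S = fst ` set w"
  have st: "same_type x y (insert i S)" using Cons.prems by (simp add: p S_def)
  then have "same_type x y S" by (auto simp: same_type_def)
  then have "realizes y w" using Cons by (auto simp: p S_def)
  moreover have "x j < x i \<longleftrightarrow> y j < y i" if "j \<in> S" for j
    using st that unfolding same_type_def by (metis insertCI shift_0 zero_le)
  moreover have "{b \<in> labels S. x i < tok x b} = {b \<in> labels S. y i < tok y b}"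
    using st by (auto simp: labels_def same_type_def)
  ultimately show ?case
    using Cons.prems by (simp add: p S_def ahead_def)
qed simp

lemma realizes_unique:
  assumes "realizes x w" "realizes x w'" "fst ` set w = fst ` set w'"
  shows "w = w'"
  using assms
proof (induction w arbitrary: w')
  case (Cons p w)
  then obtain p' v where w': "w' = p' # v" by (cases w') auto
  obtain i r where p: "p = (i, r)" by fastforce
  obtain i' r' where p': "p' = (i', r')" by fastforce
  have S: "insert i (fst ` set w) = insert i' (fst ` set v)"
    using Cons.prems by (simp add: w' p p')
  have less: "\<forall>j\<in>fst ` set w. x j < x i" "\<forall>j\<in>fst ` set v. x j < x i'"
    using Cons.prems by (auto simp: w' p p')
  then have "i = i'" using S by (metis insert_iff less_asym)
  moreover have "i \<notin> fst ` set w" "i' \<notin> fst ` set v" using less by blast+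
  ultimately have "fst ` set w = fst ` set v" using S by (metis insert_ident)
  then show ?case using Cons \<open>i = i'\<close> by (simp add: w' p p')
qed simp

lemma realizes_valid:
  assumes "realizes x w" "generic x (fst ` set w)"
  shows "valid m 1 w"
  using assms
proof (induction w)
  case (Cons p w)
  obtain i r where p: "p = (i, r)" by fastforce
  have v: "valid m 1 w" "i \<notin> fst ` set w" "r = ahead x (fst ` set w) (x i)"
    using Cons generic_subset[of x "fst ` set (p # w)" "fst ` set w"] by (auto simp: p)
  have "r \<le> bound m 1 w"
  proof (cases w)
    case Nil
    have "card {b \<in> labels ({} :: 'a set). x i < tok x b} \<le> card {None :: ('a \<times> nat) option}"
      by (intro card_mono) (auto simp: labels_def)
    then show ?thesis using v by (simp add: Nil ahead_def)
  next
    case (Cons q u)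
    obtain j s where q: "q = (j, s)" by fastforce
    have "r \<le> ahead x (fst ` set w) (x j)"
      unfolding v(3) using \<open>realizes x (p # w)\<close>
      by (intro ahead_antimono) (auto simp: p Cons q)
    also have "fst ` set w = insert j (fst ` set u)" by (simp add: Cons q)
    also have "ahead x (insert j (fst ` set u)) (x j) = s + m"
      using \<open>realizes x (p # w)\<close> \<open>generic x (fst ` set (p # w))\<close>
      by (subst ahead_insert_self) (auto simp: p Cons q generic_def)
    finally show ?thesis by (simp add: Cons q)
  qed
  with v show ?case by (auto simp: p)
qed simp

text \<open>Every generic point has a code: add the indices in the order of their coordinates.\<close>

lemma realizes_exists:
  assumes "finite S" "generic x S"
  shows "\<exists>w. realizes x w \<and> fst ` set w = S"
  using assms
proof (induction S rule: finite_ranking_induct[where f = x])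
  case empty
  then show ?case by (intro exI[of _ "[]"]) simp
next
  case (insert i S)
  show ?case
  proof (cases "i \<in> S")
    case True
    with insert show ?thesis by (simp add: insert_absorb)
  next
    case False
    obtain w where w: "realizes x w" "fst ` set w = S"
      using insert generic_subset by blast
    have "x j < x i" if "j \<in> S" for j
    proof -
      have "x j \<noteq> shift 0 (x i)" using insert.prems False that unfolding generic_def
        by (metis DiffI insertCI singletonD zero_le)
      then show ?thesis using insert.hyps that by (simp add: less_le)
    qed
    with w show ?thesis
      by (intro exI[of _ "(i, ahead x S (x i)) # w"]) auto
  qed
qed

end

text \<open>
  Among distinct numbers, a point can be placed with any prescribed number \<open>r\<close> of them above it, as
  long as at least \<open>r\<close> lie above the starting point \<open>c\<close>: move \<open>c\<close> past the smallest one until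
  exactly \<open>r\<close> are left.
\<close>

lemma exists_with_card_above:
  fixes f :: "'b \<Rightarrow> real"
  assumes "finite B" "inj_on f B" "r \<le> card {b \<in> B. c < f b}"
  shows "\<exists>y>c. y \<notin> f ` B \<and> card {b \<in> B. y < f b} = r"
  using assms(3)
proof (induction "card {b \<in> B. c < f b}" arbitrary: c rule: less_induct)
  case less
  define A where "A = {b \<in> B. c < f b}"
  have "finite A" using assms(1) by (simp add: A_def)
  show ?case
  proof (cases "r = card A")
    case True
    \<comment> \<open>Inserting \<open>c + 1\<close> keeps the set nonempty when nothing lies above \<open>c\<close>.\<close>
    define d where "d = Min (insert (c + 1) (f ` A))"
    have d: "c < d" using \<open>finite A\<close> by (simp add: d_def A_def)
    have dle: "d \<le> f b" if "b \<in> A" for b using \<open>finite A\<close> that by (simp add: d_def)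
    obtain y where y: "c < y" "y < d" using d dense by blast
    have "{b \<in> B. y < f b} = A" using y dle by (force simp: A_def)
    moreover have "y \<notin> f ` B" using y dle by (force simp: A_def)
    ultimately show ?thesis using y True by blast
  next
    case False
    then have r: "r < card A" using less.prems by (simp add: A_def)
    then have "A \<noteq> {}" by auto
    then have "Min (f ` A) \<in> f ` A" using \<open>finite A\<close> by (intro Min_in) auto
    then obtain b where b: "b \<in> A" "f b = Min (f ` A)" by auto
    have bmin: "f b \<le> f b'" if "b' \<in> A" for b' using b \<open>finite A\<close> that by simp
    have "{b' \<in> B. f b < f b'} = A - {b}"
      using b(1) bmin assms(2) by (force simp: A_def inj_on_def less_le)
    then have c: "card {b' \<in> B. f b < f b'} = card A - 1"
      using b(1) by simp
    obtain y where "f b < y" "y \<notin> f ` B" "card {b' \<in> B. y < f b'} = r"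
    proof -
      have "card {b' \<in> B. f b < f b'} < card {b \<in> B. c < f b}" "r \<le> card {b' \<in> B. f b < f b'}"
        using c r by (simp_all add: A_def)
      then show ?thesis using less.hyps that by blast
    qed
    moreover have "c < f b" using b(1) by (simp add: A_def)
    ultimately show ?thesis by (intro exI[of _ y]) auto
  qed
qed

context shifts begin

text \<open>
  Coordinates are placed one after the other, each to the right of the previous ones. The bound on
  \<open>r\<close> is the number of tokens that are still ahead, so there is a gap with \<open>r\<close> tokens to the right
  of it. Any point of this open gap avoids the tokens, and later coordinates meet no hyperplane
  other than through a token.
\<close>

lemma valid_realizable:
  assumes "valid m 1 w"
  shows "\<exists>x. generic x (fst ` set w) \<and> realizes x w"
  using assms
proof (induction w)
  case Nil
  then show ?case by (simp add: generic_def)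
next
  case (Cons p w)
  obtain i r where p: "p = (i, r)" by fastforce
  define S where "S = fst ` set w"
  obtain x where x: "generic x S" "realizes x w"
    using Cons by (auto simp: S_def p)
  have i: "i \<notin> S" "r \<le> bound m 1 w" using Cons.prems by (auto simp: S_def p)
  have "\<exists>c. (\<forall>j\<in>S. x j \<le> c) \<and> bound m 1 w = ahead x S c"
  proof (cases w)
    case Nil
    \<comment> \<open>Any negative starting point has the token \<open>0\<close> ahead of it.\<close>
    have "{b \<in> labels {}. - 1 < tok x b} = {None}" by (auto simp: labels_def)
    then show ?thesis by (intro exI[of _ "- 1"]) (simp add: Nil S_def ahead_def)
  next
    case (Cons q u)
    obtain j s where q: "q = (j, s)" by fastforce
    have S: "S = insert j (fst ` set u)" by (simp add: S_def Cons q)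
    have "ahead x S (x j) = s + m"
      unfolding S by (subst ahead_insert_self) (use x S in \<open>auto simp: Cons q generic_def\<close>)
    moreover have "\<forall>j'\<in>S. x j' \<le> x j"
      using x(2) by (force simp: Cons q S)
    ultimately show ?thesis by (auto simp: Cons q)
  qed
  then obtain c where c: "\<forall>j\<in>S. x j \<le> c" "r \<le> ahead x S c" using i by auto
  obtain y where y: "c < y" "y \<notin> tok x ` labels S" "ahead x S y = r"
    using exists_with_card_above[OF finite_labels inj_on_tok[OF x(1)], of r c] c
    by (auto simp: ahead_def S_def)
  define z where "z = x(i := y)"
  have z: "z i = y" "\<And>j. j \<in> S \<Longrightarrow> z j = x j" using i by (auto simp: z_def)
  have less: "x j < y" if "j \<in> S" for j using that y c by force
  have "same_type x z S" by (simp add: same_type_def z)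
  then have "realizes z w" using x same_type_realizes by (simp add: S_def)
  moreover have "{b \<in> labels S. y < tok z b} = {b \<in> labels S. y < tok x b}"
    using z by (auto simp: labels_def)
  ultimately have "realizes z (p # w)"
    using y(3) z less by (simp add: p S_def[symmetric] ahead_def)
  moreover have "generic z (insert i S)"
  proof -
    have "y \<noteq> 0" using y(2) by (force simp: labels_def)
    moreover have "y \<noteq> shift k (x j)" if "j \<in> S" "k \<le> m" for j k
    proof (cases "k = 0")
      case True
      then show ?thesis using less that by force
    next
      case False
      then have "Some (j, k) \<in> labels S" using that by (auto simp: labels_def)
      then have "tok x (Some (j, k)) \<in> tok x ` labels S" by (rule imageI)
      then show ?thesis using y(2) by auto
    qed
    moreover have "x j \<noteq> shift k y" if "j \<in> S" for j k
      using less[OF that] le_shift[of y k] by auto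
    ultimately show ?thesis
      using x(1) i(1) z unfolding generic_def by (auto simp: z_def)
  qed
  ultimately show ?case by (auto simp: p S_def)
qed

section \<open>Regions\<close>

text \<open>
  All ordered pairs \<open>i \<noteq> j\<close> are used here, while the arrangement has \<open>i < j\<close>. The hyperplanes are the
  same, because exchanging \<open>i\<close> and \<open>j\<close> replaces \<open>k\<close> by \<open>- k\<close>.
\<close>

definition normals :: "(real ^ 'n) set" where
  "normals = range (\<lambda>i. axis i 1) \<union>
     (\<lambda>(i, j, k). axis i 1 - (a powi k) *\<^sub>R axis j 1) ` {(i, j, k). i \<noteq> j \<and> k \<in> {- int m..int m}}"

lemma finite_normals: "finite (normals :: (real ^ 'n) set)"
proof -
  have "finite ((UNIV :: 'n set) \<times> (UNIV :: 'n set) \<times> {- int m..int m})" by simp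
  then have "finite {(i :: 'n, j :: 'n, k). i \<noteq> j \<and> k \<in> {- int m..int m}}"
    by (rule rev_finite_subset) auto
  then show ?thesis by (simp add: normals_def)
qed

lemma mem_cell_normals_iff:
  "y \<in> cell normals x \<longleftrightarrow> (\<forall>i. 0 < x $ i * y $ i) \<and>
     (\<forall>i j k. i \<noteq> j \<longrightarrow> k \<in> {- int m..int m} \<longrightarrow>
        0 < (x $ i - a powi k * x $ j) * (y $ i - a powi k * y $ j))"
  by (auto simp: cell_def normals_def ball_Un inner_diff_left inner_axis')

lemma generic_not_on_hyperplane:
  assumes "generic (($) x) UNIV" "i \<noteq> j" "k \<in> {- int m..int m}"
  shows "x $ i \<noteq> a powi k * x $ j"
proof -
  have "nat \<bar>k\<bar> \<le> m" using assms by auto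
  then have "x $ i \<noteq> shift (nat \<bar>k\<bar>) (x $ j)" "x $ j \<noteq> shift (nat \<bar>k\<bar>) (x $ i)"
    "x $ i \<noteq> 0" "x $ j \<noteq> 0"
    using assms by (auto simp: generic_def)
  then show ?thesis by (simp add: eq_powi_iff_shift)
qed

lemma complement_exp_arrangement:
  fixes x :: "real ^ 'n::{finite,linorder}"
  shows "x \<in> - \<Union>(exp_arrangement a m) \<longleftrightarrow> generic (($) x) UNIV"
proof
  assume x: "x \<in> - \<Union>(exp_arrangement a m)"
  then have nz: "x $ i \<noteq> 0" for i by (auto simp: exp_arrangement_def)
  have ne: "x $ i \<noteq> a powi k * x $ j" if "k \<in> {- int m..int m}" "i < j" for i j k
  proof -
    have "{x. x $ i = a powi k * x $ j} \<in> exp_arrangement a m"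
      using that unfolding exp_arrangement_def by blast
    then show ?thesis using x by blast
  qed
  have "x $ i \<noteq> shift k (x $ j)" if "i \<noteq> j" "k \<le> m" for i j k
  proof
    assume eq: "x $ i = shift k (x $ j)"
    define l where "l = (if x $ j > 0 then int k else - int k)"
    have l: "l \<in> {- int m..int m}" "- l \<in> {- int m..int m}" "x $ i = a powi l * x $ j"
      using that(2) eq by (auto simp: l_def shift_eq_powi)
    then have "x $ j = a powi (- l) * x $ i" using eq_powi_swap by blast
    moreover consider "i < j" | "j < i" using \<open>i \<noteq> j\<close> linorder_less_linear[of i j] by blast
    ultimately show False
      using ne[OF l(1), of i j] ne[OF l(2), of j i] l(3) by cases auto
  qed
  then show "generic (($) x) UNIV"
    using nz by (auto simp: generic_def)
next
  assume x: "generic (($) x) UNIV"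
  have "x $ i \<noteq> 0" for i using x by (auto simp: generic_def)
  then show "x \<in> - \<Union>(exp_arrangement a m)"
    using generic_not_on_hyperplane[OF x] by (force simp: exp_arrangement_def)
qed

text \<open>
  Types are defined by the nonlinear shifts. On a cell the signs of the coordinates are constant, so
  there each shift is multiplication by a fixed power of \<open>a\<close>, and each comparison with a shift is
  a linear inequality.
\<close>

lemma same_type_class_eq_cell:
  fixes x :: "real ^ 'n"
  assumes x: "generic (($) x) UNIV"
  shows "{y. generic (($) y) UNIV \<and> same_type (($) x) (($) y) UNIV} = cell normals x"
proof (intro equalityI subsetI)
  fix y assume "y \<in> {y. generic (($) y) UNIV \<and> same_type (($) x) (($) y) UNIV}"
  then have y: "generic (($) y) UNIV" and st: "same_type (($) x) (($) y) UNIV" by auto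
  have nz: "x $ i \<noteq> 0" "y $ i \<noteq> 0" "x $ i < 0 \<longleftrightarrow> y $ i < 0" for i
    using x y st by (auto simp: generic_def same_type_def)
  then have pos: "0 < x $ i \<longleftrightarrow> 0 < y $ i" for i
    by (metis linorder_neq_iff order_less_not_sym)
  have "0 < (x $ i - a powi k * x $ j) * (y $ i - a powi k * y $ j)"
    if "i \<noteq> j" and k: "k \<in> {- int m..int m}" for i j k
  proof -
    define l where "l = nat \<bar>k\<bar>"
    have "l \<le> m" using k by (auto simp: l_def)
    then have "x $ i < shift l (x $ j) \<longleftrightarrow> y $ i < shift l (y $ j)"
      "x $ j < shift l (x $ i) \<longleftrightarrow> y $ j < shift l (y $ i)"
      "x $ j \<noteq> shift l (x $ i)" "y $ j \<noteq> shift l (y $ i)"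
      using st x y that(1) by (auto simp: same_type_def generic_def)
    then have "x $ i < a powi k * x $ j \<longleftrightarrow> y $ i < a powi k * y $ j"
      using nz pos by (auto simp: less_powi_iff_shift l_def[symmetric])
    moreover have "x $ i \<noteq> a powi k * x $ j" "y $ i \<noteq> a powi k * y $ j"
      using x y that generic_not_on_hyperplane by blast+
    ultimately show ?thesis by (auto simp: zero_less_mult_iff)
  qed
  moreover have "0 < x $ i * y $ i" for i
    using nz[of i] by (auto simp: zero_less_mult_iff)
  ultimately show "y \<in> cell normals x" by (auto simp: mem_cell_normals_iff)
next
  fix y assume "y \<in> cell normals x"
  then have pos: "0 < x $ i * y $ i"
    and lin: "i \<noteq> j \<Longrightarrow> k \<in> {- int m..int m} \<Longrightarrow>
        0 < (x $ i - a powi k * x $ j) * (y $ i - a powi k * y $ j)" for i j k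
    by (auto simp: mem_cell_normals_iff)
  have nz: "x $ i \<noteq> 0" "y $ i \<noteq> 0" and sgn: "x $ i < 0 \<longleftrightarrow> y $ i < 0" "0 < x $ i \<longleftrightarrow> 0 < y $ i" for i
    using pos[of i] by (auto simp: zero_less_mult_iff)
  have prod: "0 < (x $ i - shift k (x $ j)) * (y $ i - shift k (y $ j))"
    if "i \<noteq> j" "k \<le> m" for i j k
    using that sgn(2)[of j] lin[of i j "if x $ j > 0 then int k else - int k"]
    by (auto simp: shift_eq_powi split: if_splits)
  have ne: "y $ i \<noteq> shift k (y $ j)"
    and "x $ i < shift k (x $ j) \<longleftrightarrow> y $ i < shift k (y $ j)" if "i \<noteq> j" "k \<le> m" for i j k
    using prod[OF that] by (auto simp: zero_less_mult_iff)
  moreover have "x $ i < shift k (x $ i) \<longleftrightarrow> y $ i < shift k (y $ i)" for i k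
    using nz by (simp add: less_shift)
  ultimately have "x $ i < shift k (x $ j) \<longleftrightarrow> y $ i < shift k (y $ j)" if "k \<le> m" for i j k
    using that by (cases "i = j") auto
  then have "same_type (($) x) (($) y) UNIV"
    using sgn(1) by (simp add: same_type_def)
  moreover have "generic (($) y) UNIV"
    using nz ne by (simp add: generic_def)
  ultimately
  show "y \<in> {y. generic (($) y) UNIV \<and> same_type (($) x) (($) y) UNIV}" by simp
qed

definition region_of :: "('n \<times> nat) list \<Rightarrow> (real ^ 'n) set" where
  "region_of w = {x. generic (($) x) UNIV \<and> realizes (($) x) w}"

lemma region_of_eq_cell:
  fixes x :: "real ^ 'n"
  assumes "x \<in> region_of w" "fst ` set w = UNIV"
  shows "region_of w = cell normals x"
proof -
  have "region_of w = {y. generic (($) y) UNIV \<and> same_type (($) x) (($) y) UNIV}"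
    using assms realizes_same_type[of "($) x" w] same_type_realizes[of "($) x" w]
    by (auto simp: region_of_def)
  also have "\<dots> = cell normals x"
    using assms by (intro same_type_class_eq_cell) (simp add: region_of_def)
  finally show ?thesis .
qed

lemma region_of_nonempty:
  fixes w :: "('n::finite \<times> nat) list"
  assumes "valid m 1 w" "fst ` set w = UNIV"
  shows "region_of w \<noteq> {}"
proof -
  obtain x where x: "generic x UNIV" "realizes x w"
    using valid_realizable[OF assms(1)] assms(2) by auto
  moreover have "($) (vec_lambda x) = x" by (simp add: fun_eq_iff)
  ultimately have "vec_lambda x \<in> region_of w" by (simp add: region_of_def)
  then show ?thesis by blast
qed

text \<open>
  The sets \<open>region_of w\<close> for valid codes \<open>w\<close> are open, connected, nonempty and disjoint, and cover the
  complement of the arrangement, so they are its components.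
\<close>

lemma card_regions:
  "card (regions (exp_arrangement a m :: (real ^ 'n::{finite,linorder}) set set)) =
     code_count m CARD('n::{finite,linorder}) 1"
proof -
  define W where "W = {w :: ('n::{finite,linorder} \<times> nat) list. valid m 1 w \<and> fst ` set w = UNIV}"
  have disj: "w = w'" if "x \<in> region_of w" "x \<in> region_of w'" "w \<in> W" "w' \<in> W" for w w' x
    using that realizes_unique[of "($) x" w w'] by (simp add: region_of_def W_def)
  have ne: "region_of w \<noteq> {}" if "w \<in> W" for w
    using that region_of_nonempty[of w] by (simp add: W_def)
  have "regions (exp_arrangement a m) = region_of ` W"
    unfolding regions_def
  proof (rule components_open_unique)
    show "pairwise disjnt (region_of ` W)"
      using disj by (auto simp: pairwise_def disjnt_def)
    show "\<Union>(region_of ` W) = - \<Union>(exp_arrangement a m)"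
    proof (intro equalityI subsetI)
      fix x :: "real ^ 'n::{finite,linorder}" assume "x \<in> - \<Union>(exp_arrangement a m)"
      then have x: "generic (($) x) UNIV" by (simp only: complement_exp_arrangement)
      then obtain w where w: "realizes (($) x) w" "fst ` set w = UNIV"
        using realizes_exists[of UNIV "($) x"] by auto
      then have "w \<in> W" using realizes_valid[of "($) x" w] x by (simp add: W_def)
      then show "x \<in> \<Union>(region_of ` W)" using x w by (auto simp: region_of_def)
    next
      fix x :: "real ^ 'n::{finite,linorder}" assume "x \<in> \<Union>(region_of ` W)"
      then show "x \<in> - \<Union>(exp_arrangement a m)"
        unfolding complement_exp_arrangement by (auto simp: region_of_def)
    qed
    show "open X \<and> connected X \<and> X \<noteq> {}" if "X \<in> region_of ` W" for X :: "(real ^ 'n::{finite,linorder}) set"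
    proof -
      obtain w x where wx: "w \<in> W" "X = region_of w" "x \<in> X"
        using \<open>X \<in> region_of ` W\<close> ne by blast
      then have "X = cell normals x" using region_of_eq_cell[of x w] by (simp add: W_def)
      then show ?thesis
        using wx(3) open_cell[OF finite_normals] convex_connected[OF convex_cell] by auto
    qed
  qed
  moreover have "inj_on region_of W"
    using disj ne by (metis ex_in_conv inj_onI)
  ultimately have "card (regions (exp_arrangement a m :: (real ^ 'n::{finite,linorder}) set set)) = card W"
    by (simp add: card_image)
  also have "\<dots> = code_count m CARD('n) 1"
    using card_valid[of "UNIV :: 'n::{finite,linorder} set" m 1] by (simp add: W_def)
  finally show ?thesis .
qed

end

theorem corollary2p8:
  fixes a :: real and m n :: nat
  assumes "m \<ge> 1" and "n \<ge> 1" and "a > 1"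
    and "CARD('n) = n"
  shows "real (card (regions (exp_arrangement a m :: (real ^ 'n::{finite,linorder}) set set)))
           = 2 * fact (n * m + n + 1) / fact (n * m + 2)"
proof -
  interpret shifts a m by unfold_locales fact
  have "code_count m n 1 * fact (n * m + 2) = 2 * fact (n * m + n + 1)"
    using code_count_closed_form[of m n 1] by (simp add: algebra_simps)
  then have "real (code_count m n 1) * fact (n * m + 2) = 2 * fact (n * m + n + 1)"
    by (metis of_nat_fact of_nat_mult of_nat_numeral)
  then show ?thesis
    using card_regions[where 'n = 'n] assms(4) by (simp only: nonzero_eq_divide_eq[OF fact_nonzero])
qed

end
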